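(* Let $S$ be a $\Gamma$-semigroup, let $Q$ be a non-empty set, let $I$ be a non-empty subset of $S$, and let $\chi_{I\times Q}:S\times Q\to[0,1]$ be the characteristic function of $I\times Q$. Then $I$ is a left ideal (respectively right ideal, ideal) of $S$ if and only if $\chi_{I\times Q}$ is a $Q$-fuzzy left ideal (respectively $Q$-fuzzy right ideal, $Q$-fuzzy ideal) of $S$.
   Context: $\Gamma$-semigroup: non-empty sets $S$ and $\Gamma$ together with mappings $S\times\Gamma\times S\to S$, $(a,\alpha,b)\mapsto a\alpha b$, and $\Gamma\times S\times\Gamma\to\Gamma$, $(\alpha,a,\beta)\mapsto\alpha a\beta$, such that $(a\alpha b)\beta c=a(\alpha b\beta)c=a\alpha(b\beta c)$ and $\alpha(a\beta b)\gamma=(\alpha a\beta)b\gamma=\alpha a(\beta b\gamma)$ for all $a,b,c\in S$ and $\alpha,\beta,\gamma\in\Gamma$; one says $S$ is a $\Gamma$-semigroup. A left (right) ideal of $S$ is a non-empty subset $A\subseteq S$ with $S\Gamma A\subseteq A$ (respectively $A\Gamma S\subseteq A$), where $X\Gamma Y=\{x\gamma y: x\in X,\gamma\in\Gamma,y\in Y\}$. An ideal is a non-empty subset that is both a left and a right ideal. A $Q$-fuzzy subset of a non-empty set $X$ ($Q$ a non-empty set) is a function $\mu:X\times Q\to[0,1]$; it is non-empty if it is not identically $0$. A non-empty $Q$-fuzzy subset $\mu$ of $S$ is a $Q$-fuzzy left ideal if $\mu(x\gamma y,q)\ge\mu(y,q)$ for all $x,y\in S,\gamma\in\Gamma,q\in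 Q$; a $Q$-fuzzy right ideal if $\mu(x\gamma y,q)\ge\mu(x,q)$ for all $x,y\in S,\gamma\in\Gamma,q\in Q$; and a $Q$-fuzzy ideal if it is both. *)

theory Defs
  imports Complex_Main "HOL-Library.FuncSet" "HOL-Library.Indicator_Function"
begin

text \<open>
  \<open>mul a \<alpha> b\<close> stands for the element \<open>a\<alpha>b\<close> of \<open>S\<close>, and
  \<open>gmul \<alpha> a \<beta>\<close> for the element \<open>\<alpha>a\<beta>\<close> of \<open>\<Gamma>\<close>.
\<close>

locale gamma_semigroup =
  fixes S :: "'s set"
    and \<Gamma> :: "'g set"
    and mul :: "'s \<Rightarrow> 'g \<Rightarrow> 's \<Rightarrow> 's"
    and gmul :: "'g \<Rightarrow> 's \<Rightarrow> 'g \<Rightarrow> 'g"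
  assumes S_nonempty: "S \<noteq> {}"
    and \<Gamma>_nonempty: "\<Gamma> \<noteq> {}"
    and mul_closed:
      "\<lbrakk>a \<in> S; \<alpha> \<in> \<Gamma>; b \<in> S\<rbrakk> \<Longrightarrow> mul a \<alpha> b \<in> S"
    and gmul_closed:
      "\<lbrakk>\<alpha> \<in> \<Gamma>; a \<in> S; \<beta> \<in> \<Gamma>\<rbrakk> \<Longrightarrow> gmul \<alpha> a \<beta> \<in> \<Gamma>"
    and mul_gmul:
      "\<lbrakk>a \<in> S; b \<in> S; c \<in> S; \<alpha> \<in> \<Gamma>; \<beta> \<in> \<Gamma>\<rbrakk>
        \<Longrightarrow> mul (mul a \<alpha> b) \<beta> c = mul a (gmul \<alpha> b \<beta>) c"
    and mul_assoc:
      "\<lbrakk>a \<in> S; b \<in> S; c \<in> S; \<alpha> \<in> \<Gamma>; \<beta> \<in> \<Gamma>\<rbrakk>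
        \<Longrightarrow> mul a (gmul \<alpha> b \<beta>) c = mul a \<alpha> (mul b \<beta> c)"
    and gmul_mul:
      "\<lbrakk>a \<in> S; b \<in> S; \<alpha> \<in> \<Gamma>; \<beta> \<in> \<Gamma>; \<gamma> \<in> \<Gamma>\<rbrakk>
        \<Longrightarrow> gmul \<alpha> (mul a \<beta> b) \<gamma> = gmul (gmul \<alpha> a \<beta>) b \<gamma>"
    and gmul_assoc:
      "\<lbrakk>a \<in> S; b \<in> S; \<alpha> \<in> \<Gamma>; \<beta> \<in> \<Gamma>; \<gamma> \<in> \<Gamma>\<rbrakk>
        \<Longrightarrow> gmul (gmul \<alpha> a \<beta>) b \<gamma> = gmul \<alpha> a (gmul \<beta> b \<gamma>)"

definition gamma_prod ::
  "'g set \<Rightarrow> ('s \<Rightarrow> 'g \<Rightarrow> 's \<Rightarrow> 's) \<Rightarrow> 's set \<Rightarrow> 's set \<Rightarrow> 's set" where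
  "gamma_prod \<Gamma> mul X Y = {mul x \<gamma> y | x \<gamma> y. x \<in> X \<and> \<gamma> \<in> \<Gamma> \<and> y \<in> Y}"

definition left_ideal ::
  "'s set \<Rightarrow> 'g set \<Rightarrow> ('s \<Rightarrow> 'g \<Rightarrow> 's \<Rightarrow> 's) \<Rightarrow> 's set \<Rightarrow> bool" where
  "left_ideal S \<Gamma> mul A \<longleftrightarrow> A \<noteq> {} \<and> A \<subseteq> S \<and> gamma_prod \<Gamma> mul S A \<subseteq> A"

definition right_ideal ::
  "'s set \<Rightarrow> 'g set \<Rightarrow> ('s \<Rightarrow> 'g \<Rightarrow> 's \<Rightarrow> 's) \<Rightarrow> 's set \<Rightarrow> bool" where
  "right_ideal S \<Gamma> mul A \<longleftrightarrow> A \<noteq> {} \<and> A \<subseteq> S \<and> gamma_prod \<Gamma> mul A S \<subseteq> A"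

definition two_sided_ideal ::
  "'s set \<Rightarrow> 'g set \<Rightarrow> ('s \<Rightarrow> 'g \<Rightarrow> 's \<Rightarrow> 's) \<Rightarrow> 's set \<Rightarrow> bool" where
  "two_sided_ideal S \<Gamma> mul A \<longleftrightarrow> left_ideal S \<Gamma> mul A \<and> right_ideal S \<Gamma> mul A"

text \<open>
  A \<open>Q\<close>-fuzzy subset of \<open>X\<close> is represented by a function on the whole type of which
  only the values on \<open>X \<times> Q\<close> matter; in particular being non-empty refers to
  \<open>X \<times> Q\<close> only.
\<close>

definition fuzzy_subset :: "'q set \<Rightarrow> 's set \<Rightarrow> ('s \<times> 'q \<Rightarrow> real) \<Rightarrow> bool" where
  "fuzzy_subset Q X \<mu> \<longleftrightarrow> \<mu> \<in> X \<times> Q \<rightarrow> {0..1}"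

definition fuzzy_nonempty :: "'q set \<Rightarrow> 's set \<Rightarrow> ('s \<times> 'q \<Rightarrow> real) \<Rightarrow> bool" where
  "fuzzy_nonempty Q X \<mu> \<longleftrightarrow> \<not> (\<forall>z \<in> X \<times> Q. \<mu> z = 0)"

definition fuzzy_left_ideal ::
  "'q set \<Rightarrow> 's set \<Rightarrow> 'g set \<Rightarrow> ('s \<Rightarrow> 'g \<Rightarrow> 's \<Rightarrow> 's) \<Rightarrow> ('s \<times> 'q \<Rightarrow> real) \<Rightarrow> bool" where
  "fuzzy_left_ideal Q S \<Gamma> mul \<mu> \<longleftrightarrow>
     fuzzy_subset Q S \<mu> \<and> fuzzy_nonempty Q S \<mu> \<and>
     (\<forall>x\<in>S. \<forall>y\<in>S. \<forall>\<gamma>\<in>\<Gamma>. \<forall>q\<in>Q. \<mu> (mul x \<gamma> y, q) \<ge> \<mu> (y, q))"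

definition fuzzy_right_ideal ::
  "'q set \<Rightarrow> 's set \<Rightarrow> 'g set \<Rightarrow> ('s \<Rightarrow> 'g \<Rightarrow> 's \<Rightarrow> 's) \<Rightarrow> ('s \<times> 'q \<Rightarrow> real) \<Rightarrow> bool" where
  "fuzzy_right_ideal Q S \<Gamma> mul \<mu> \<longleftrightarrow>
     fuzzy_subset Q S \<mu> \<and> fuzzy_nonempty Q S \<mu> \<and>
     (\<forall>x\<in>S. \<forall>y\<in>S. \<forall>\<gamma>\<in>\<Gamma>. \<forall>q\<in>Q. \<mu> (mul x \<gamma> y, q) \<ge> \<mu> (x, q))"

definition fuzzy_ideal ::
  "'q set \<Rightarrow> 's set \<Rightarrow> 'g set \<Rightarrow> ('s \<Rightarrow> 'g \<Rightarrow> 's \<Rightarrow> 's) \<Rightarrow> ('s \<times> 'q \<Rightarrow> real) \<Rightarrow> bool" where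
  "fuzzy_ideal Q S \<Gamma> mul \<mu> \<longleftrightarrow>
     fuzzy_left_ideal Q S \<Gamma> mul \<mu> \<and> fuzzy_right_ideal Q S \<Gamma> mul \<mu>"

end

theory Submission
  imports Defs
begin

text \<open>A characteristic function takes only the values 0 and 1, so an inequality between two of
  its values is an implication between memberships. By \<open>indicator_Times_le_iff\<close>, each
  fuzzy inequality at a fixed q in \<open>Q\<close> says that membership in \<open>I\<close> passes
  from a factor to the product, a condition free of q. This is exactly the absorption law of a
  one-sided ideal; the two-sided case is the conjunction of the one-sided ones.\<close>

lemma indicator_Times_le_iff:
  assumes "q \<in> Q"
  shows "(indicator (I \<times> Q) (x, q) :: real) \<le> indicator (I \<times> Q) (y, q) \<longleftrightarrow> (x \<in> I \<longrightarrow> y \<in> I)"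
  using assms by (auto simp: indicator_def)

lemma fuzzy_subset_indicator: "fuzzy_subset Q S (indicator A)"
  by (auto simp: fuzzy_subset_def indicator_def)

text \<open>Any point of \<open>I \<times> Q\<close> is a witness: it lies in
  \<open>S \<times> Q\<close> because \<open>I \<subseteq> S\<close>, and the value there is
  1.\<close>

lemma fuzzy_nonempty_indicator_Times:
  assumes "Q \<noteq> {}" and "I \<noteq> {}" and "I \<subseteq> S"
  shows "fuzzy_nonempty Q S (indicator (I \<times> Q))"
  using assms by (fastforce simp: fuzzy_nonempty_def indicator_def)

lemma left_ideal_iff_fuzzy_left_ideal:
  assumes "Q \<noteq> {}" and "I \<noteq> {}" and "I \<subseteq> S"
  shows "left_ideal S \<Gamma> mul I \<longleftrightarrow> fuzzy_left_ideal Q S \<Gamma> mul (indicator (I \<times> Q))"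
proof -
  \<comment> \<open>Since \<open>I \<subseteq> S\<close>, letting y range over \<open>S\<close>
    under the premise \<open>y \<in> I\<close> is the same as letting it range over
    \<open>I\<close>; the fuzzy inequality unfolds to this shape.\<close>
  have "left_ideal S \<Gamma> mul I \<longleftrightarrow> (\<forall>x\<in>S. \<forall>y\<in>S. \<forall>\<gamma>\<in>\<Gamma>. y \<in> I \<longrightarrow> mul x \<gamma> y \<in> I)"
    using assms unfolding left_ideal_def gamma_prod_def by blast
  also have "\<dots> \<longleftrightarrow> fuzzy_left_ideal Q S \<Gamma> mul (indicator (I \<times> Q))"
    using assms
    \<comment> \<open>Once the inequality is rewritten, q no longer occurs in the body. The
      quantifier over \<open>Q\<close> then reduces to the existence of some q, which
      \<open>ex_in_conv\<close> turns into \<open>Q \<noteq> {}\<close>.\<close>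
    by (simp add: fuzzy_left_ideal_def indicator_Times_le_iff fuzzy_subset_indicator
        fuzzy_nonempty_indicator_Times ex_in_conv)
  finally show ?thesis .
qed

text \<open>The mirror image of the left case: the factor whose membership is inherited by the
  product is now the left one.\<close>

lemma right_ideal_iff_fuzzy_right_ideal:
  assumes "Q \<noteq> {}" and "I \<noteq> {}" and "I \<subseteq> S"
  shows "right_ideal S \<Gamma> mul I \<longleftrightarrow> fuzzy_right_ideal Q S \<Gamma> mul (indicator (I \<times> Q))"
proof -
  have "right_ideal S \<Gamma> mul I \<longleftrightarrow> (\<forall>x\<in>S. \<forall>y\<in>S. \<forall>\<gamma>\<in>\<Gamma>. x \<in> I \<longrightarrow> mul x \<gamma> y \<in> I)"
    using assms unfolding right_ideal_def gamma_prod_def by blast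
  also have "\<dots> \<longleftrightarrow> fuzzy_right_ideal Q S \<Gamma> mul (indicator (I \<times> Q))"
    using assms
    by (simp add: fuzzy_right_ideal_def indicator_Times_le_iff fuzzy_subset_indicator
        fuzzy_nonempty_indicator_Times ex_in_conv)
  finally show ?thesis .
qed

theorem theorem3p4:
  fixes S :: "'s set"
    and \<Gamma> :: "'g set"
    and mul :: "'s \<Rightarrow> 'g \<Rightarrow> 's \<Rightarrow> 's"
    and gmul :: "'g \<Rightarrow> 's \<Rightarrow> 'g \<Rightarrow> 'g"
    and Q :: "'q set"
    and I :: "'s set"
  assumes "gamma_semigroup S \<Gamma> mul gmul"
    and "Q \<noteq> {}"
    and "I \<noteq> {}"
    and "I \<subseteq> S"
  shows "(left_ideal S \<Gamma> mul I \<longleftrightarrow>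
            fuzzy_left_ideal Q S \<Gamma> mul (indicator (I \<times> Q) :: 's \<times> 'q \<Rightarrow> real)) \<and>
         (right_ideal S \<Gamma> mul I \<longleftrightarrow>
            fuzzy_right_ideal Q S \<Gamma> mul (indicator (I \<times> Q) :: 's \<times> 'q \<Rightarrow> real)) \<and>
         (two_sided_ideal S \<Gamma> mul I \<longleftrightarrow>
            fuzzy_ideal Q S \<Gamma> mul (indicator (I \<times> Q) :: 's \<times> 'q \<Rightarrow> real))"
  unfolding two_sided_ideal_def fuzzy_ideal_def
    left_ideal_iff_fuzzy_left_ideal[OF assms(2-4)]
    right_ideal_iff_fuzzy_right_ideal[OF assms(2-4)]
  by simp

end
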